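(* Let $\mathbf C,\mathbf D$ be strict monoidal categories with dually equivalent categories $\widehat{\mathbf C},\widehat{\mathbf D}$ (with dual tensor $\widehat\otimes$), let $F\colon\mathbf D\to\mathbf C$ be left adjoint to a strong monoidal functor $U\colon\mathbf C\to\mathbf D$, and let $T=\widehat F\widehat U$ be the monad on $\widehat{\mathbf C}$ dual to the comonad $FU$, with unit $e$, multiplication $m$ and monoidal structure $\hat\delta$. Let $h,g\colon UA\to UA$ be $U$-operators with respective duals $\rho,\sigma\colon\widehat A\to T\widehat A$. Then: (1) $h\otimes g\colon UA\otimes UA\to UA\otimes UA$ is dual to $\hat\delta\cdot(\rho\,\widehat\otimes\,\sigma)\colon\widehat A\,\widehat\otimes\,\widehat A\to T\widehat A\,\widehat\otimes\,T\widehat A\to T(\widehat A\,\widehat\otimes\,\widehat A)$. (2) $g\cdot h\colon UA\to UA\to UA$ is dual to $m\cdot T\rho\cdot\sigma\colon\widehat A\to T\widehat A\to TT\widehat A\to T\widehat A$. (3) $\mathrm{id}_{UA}\colon UA\to UA$ is dual to $e_{\widehat A}\colon\widehat A\to T\widehat A$.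
   Context: Both contravariant equivalences are written $\widehat{(-)}$, and the dual of a functor $G$ is $\widehat G=\widehat{(-)}\cdot G\cdot\widehat{(-)}$. Let $\eta,\varepsilon$ be the unit and counit of $F\dashv U$ and $\lambda\colon UX\otimes UY\cong U(X\otimes Y)$ the strong monoidal structure of $U$ (extended to all finite arities). The monad $T$ has unit $e=\hat\varepsilon$ and multiplication $m=\widehat F\hat\eta\widehat U$. The transformation $\hat\delta\colon TX\,\widehat\otimes\,TY\to T(X\,\widehat\otimes\,Y)$ is the dual of the comonoidal structure $\delta\colon FU(A\otimes B)\to FUA\otimes FUB$ of $FU$, where $\delta=\varepsilon\cdot F\lambda\cdot F(\eta\otimes\eta)\cdot F\lambda^{-1}$. Dual of a morphism: given $a\colon(UA)^{\otimes k}\to(UA)^{\otimes n}$ in $\mathbf D$, let $\alpha=\lambda\cdot a\cdot\lambda^{-1}\colon U(A^{\otimes k})\to U(A^{\otimes n})$ and let $\alpha^+=\varepsilon\cdot F\alpha\colon FU(A^{\otimes k})\to A^{\otimes n}$ be its adjoint transpose. The dual of $a$ is the morphism $\widehat{\alpha^+}\colon\widehat A^{\widehat\otimes n}\to T\widehat A^{\widehat\otimes k}$ of $\widehat{\mathbf C}$. *)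

theory Defs
  imports Main
begin

record ('o, 'a) cat =
  obj :: "'o set"
  arr :: "'a set"
  src :: "'a \<Rightarrow> 'o"
  tgt :: "'a \<Rightarrow> 'o"
  idt :: "'o \<Rightarrow> 'a"
  cmp :: "'a \<Rightarrow> 'a \<Rightarrow> 'a"  (infixl "\<cdot>\<index>" 70)

definition hom :: "('o, 'a, 'z) cat_scheme \<Rightarrow> 'o \<Rightarrow> 'o \<Rightarrow> 'a set" where
  "hom C A B = {f \<in> arr C. src C f = A \<and> tgt C f = B}"

locale category =
  fixes C :: "('o, 'a, 'z) cat_scheme" (structure)
  assumes src_obj: "f \<in> arr C \<Longrightarrow> src C f \<in> obj C"
    and tgt_obj: "f \<in> arr C \<Longrightarrow> tgt C f \<in> obj C"
    and idt_hom: "A \<in> obj C \<Longrightarrow> idt C A \<in> hom C A A"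
    and cmp_hom: "\<lbrakk>f \<in> hom C A B; g \<in> hom C B D\<rbrakk> \<Longrightarrow> g \<cdot> f \<in> hom C A D"
    and cmp_assoc:
      "\<lbrakk>f \<in> hom C A B; g \<in> hom C B D; h \<in> hom C D E\<rbrakk> \<Longrightarrow> (h \<cdot> g) \<cdot> f = h \<cdot> (g \<cdot> f)"
    and idt_left: "f \<in> hom C A B \<Longrightarrow> idt C B \<cdot> f = f"
    and idt_right: "f \<in> hom C A B \<Longrightarrow> f \<cdot> idt C A = f"

definition op_cat :: "('o, 'a, 'z) cat_scheme \<Rightarrow> ('o, 'a) cat" where
  "op_cat C = \<lparr>obj = obj C, arr = arr C, src = tgt C, tgt = src C, idt = idt C,
     cmp = (\<lambda>g f. f \<cdot>\<^bsub>C\<^esub> g)\<rparr>"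

definition inverse_arrows :: "('o, 'a, 'z) cat_scheme \<Rightarrow> 'a \<Rightarrow> 'a \<Rightarrow> bool" where
  "inverse_arrows C f g \<longleftrightarrow> f \<in> arr C \<and> g \<in> hom C (tgt C f) (src C f) \<and>
     g \<cdot>\<^bsub>C\<^esub> f = idt C (src C f) \<and> f \<cdot>\<^bsub>C\<^esub> g = idt C (tgt C f)"

definition iso :: "('o, 'a, 'z) cat_scheme \<Rightarrow> 'a \<Rightarrow> bool" where
  "iso C f \<longleftrightarrow> (\<exists>g. inverse_arrows C f g)"

definition inva :: "('o, 'a, 'z) cat_scheme \<Rightarrow> 'a \<Rightarrow> 'a" where
  "inva C f = (THE g. inverse_arrows C f g)"

record ('o, 'a, 'p, 'b) ftr =
  ob :: "'o \<Rightarrow> 'p"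
  ar :: "'a \<Rightarrow> 'b"

definition id_ftr :: "('o, 'a, 'o, 'a) ftr" where
  "id_ftr = \<lparr>ob = (\<lambda>X. X), ar = (\<lambda>f. f)\<rparr>"

definition comp_ftr :: "('p, 'b, 'q, 'c) ftr \<Rightarrow> ('o, 'a, 'p, 'b) ftr \<Rightarrow> ('o, 'a, 'q, 'c) ftr"
    (infixl "\<odot>" 70) where
  "G \<odot> F = \<lparr>ob = (\<lambda>X. ob G (ob F X)), ar = (\<lambda>f. ar G (ar F f))\<rparr>"

locale is_functor = A: category A + B: category B
  for A :: "('o, 'a, 'y) cat_scheme" and B :: "('p, 'b, 'z) cat_scheme" +
  fixes F :: "('o, 'a, 'p, 'b) ftr"
  assumes ob_obj: "X \<in> obj A \<Longrightarrow> ob F X \<in> obj B"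
    and ar_hom: "f \<in> hom A X Y \<Longrightarrow> ar F f \<in> hom B (ob F X) (ob F Y)"
    and ar_idt: "X \<in> obj A \<Longrightarrow> ar F (idt A X) = idt B (ob F X)"
    and ar_cmp: "\<lbrakk>f \<in> hom A X Y; g \<in> hom A Y Z\<rbrakk> \<Longrightarrow> ar F (g \<cdot>\<^bsub>A\<^esub> f) = ar F g \<cdot>\<^bsub>B\<^esub> ar F f"

locale nat_trans = G: is_functor A B G + H: is_functor A B H
  for A :: "('o, 'a, 'y) cat_scheme" and B :: "('p, 'b, 'z) cat_scheme"
    and G H :: "('o, 'a, 'p, 'b) ftr" +
  fixes \<phi> :: "'o \<Rightarrow> 'b"
  assumes component_hom: "X \<in> obj A \<Longrightarrow> \<phi> X \<in> hom B (ob G X) (ob H X)"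
    and naturality: "f \<in> hom A X Y \<Longrightarrow> \<phi> Y \<cdot>\<^bsub>B\<^esub> ar G f = ar H f \<cdot>\<^bsub>B\<^esub> \<phi> X"

locale nat_iso = nat_trans +
  assumes component_iso: "X \<in> obj A \<Longrightarrow> iso B (\<phi> X)"

locale adjunction =
  unit: nat_trans D D id_ftr "U \<odot> F" \<eta> + counit: nat_trans C C "F \<odot> U" id_ftr \<epsilon> +
  F: is_functor D C F + U: is_functor C D U
  for D :: "('p, 'b, 'y) cat_scheme" and C :: "('o, 'a, 'z) cat_scheme"
    and F :: "('p, 'b, 'o, 'a) ftr" and U :: "('o, 'a, 'p, 'b) ftr"
    and \<eta> :: "'p \<Rightarrow> 'b" and \<epsilon> :: "'o \<Rightarrow> 'a" +
  assumes triangle_F: "Y \<in> obj D \<Longrightarrow> \<epsilon> (ob F Y) \<cdot>\<^bsub>C\<^esub> ar F (\<eta> Y) = idt C (ob F Y)"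
    and triangle_U: "X \<in> obj C \<Longrightarrow> ar U (\<epsilon> X) \<cdot>\<^bsub>D\<^esub> \<eta> (ob U X) = idt D (ob U X)"

record ('o, 'a) moncat = "('o, 'a) cat" +
  tno :: "'o \<Rightarrow> 'o \<Rightarrow> 'o"  (infixr "\<otimes>\<index>" 75)
  tna :: "'a \<Rightarrow> 'a \<Rightarrow> 'a"  (infixr "\<boxtimes>\<index>" 75)
  unt :: "'o"

locale strict_monoidal_category = category C
  for C :: "('o, 'a, 'z) moncat_scheme" (structure) +
  assumes tno_obj: "\<lbrakk>A \<in> obj C; B \<in> obj C\<rbrakk> \<Longrightarrow> A \<otimes> B \<in> obj C"
    and unt_obj: "unt C \<in> obj C"
    and tna_hom: "\<lbrakk>f \<in> hom C A A'; g \<in> hom C B B'\<rbrakk> \<Longrightarrow> f \<boxtimes> g \<in> hom C (A \<otimes> B) (A' \<otimes> B')"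
    and tna_idt: "\<lbrakk>A \<in> obj C; B \<in> obj C\<rbrakk> \<Longrightarrow> idt C A \<boxtimes> idt C B = idt C (A \<otimes> B)"
    and tna_cmp: "\<lbrakk>f \<in> hom C A A'; f' \<in> hom C A' A''; g \<in> hom C B B'; g' \<in> hom C B' B''\<rbrakk> \<Longrightarrow>
      (f' \<cdot> f) \<boxtimes> (g' \<cdot> g) = (f' \<boxtimes> g') \<cdot> (f \<boxtimes> g)"
    and tno_assoc: "\<lbrakk>A \<in> obj C; B \<in> obj C; D \<in> obj C\<rbrakk> \<Longrightarrow> (A \<otimes> B) \<otimes> D = A \<otimes> (B \<otimes> D)"
    and tna_assoc: "\<lbrakk>f \<in> arr C; g \<in> arr C; h \<in> arr C\<rbrakk> \<Longrightarrow> (f \<boxtimes> g) \<boxtimes> h = f \<boxtimes> (g \<boxtimes> h)"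
    and tno_unit: "A \<in> obj C \<Longrightarrow> unt C \<otimes> A = A" "A \<in> obj C \<Longrightarrow> A \<otimes> unt C = A"
    and tna_unit: "f \<in> arr C \<Longrightarrow> idt C (unt C) \<boxtimes> f = f" "f \<in> arr C \<Longrightarrow> f \<boxtimes> idt C (unt C) = f"

text \<open>The clause for \<open>Suc 0\<close> makes \<open>A\<^sup>1\<close> equal to \<open>A\<close>, and hence \<open>A\<^sup>2\<close> equal to \<open>A \<otimes> A\<close>,
  even for the dual tensor below, which is unital only up to isomorphism.\<close>

fun tpow :: "('o, 'a, 'z) moncat_scheme \<Rightarrow> 'o \<Rightarrow> nat \<Rightarrow> 'o" where
  "tpow C A 0 = unt C"
| "tpow C A (Suc 0) = A"
| "tpow C A (Suc (Suc n)) = A \<otimes>\<^bsub>C\<^esub> tpow C A (Suc n)"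

locale strong_monoidal_functor =
  C: strict_monoidal_category C + D: strict_monoidal_category D + is_functor C D U
  for C :: "('o, 'a, 'y) moncat_scheme" and D :: "('p, 'b, 'z) moncat_scheme"
    and U :: "('o, 'a, 'p, 'b) ftr" +
  fixes lm :: "'o \<Rightarrow> 'o \<Rightarrow> 'b" and lu :: 'b
  assumes lam_hom: "\<lbrakk>A \<in> obj C; B \<in> obj C\<rbrakk> \<Longrightarrow> lm A B \<in> hom D (ob U A \<otimes>\<^bsub>D\<^esub> ob U B) (ob U (A \<otimes>\<^bsub>C\<^esub> B))"
    and lam_iso: "\<lbrakk>A \<in> obj C; B \<in> obj C\<rbrakk> \<Longrightarrow> iso D (lm A B)"
    and lam_natural: "\<lbrakk>f \<in> hom C A A'; g \<in> hom C B B'\<rbrakk> \<Longrightarrow>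
      lm A' B' \<cdot>\<^bsub>D\<^esub> (ar U f \<boxtimes>\<^bsub>D\<^esub> ar U g) = ar U (f \<boxtimes>\<^bsub>C\<^esub> g) \<cdot>\<^bsub>D\<^esub> lm A B"
    and lamu_hom: "lu \<in> hom D (unt D) (ob U (unt C))"
    and lamu_iso: "iso D lu"
    and lam_assoc: "\<lbrakk>X \<in> obj C; Y \<in> obj C; Z \<in> obj C\<rbrakk> \<Longrightarrow>
      lm (X \<otimes>\<^bsub>C\<^esub> Y) Z \<cdot>\<^bsub>D\<^esub> (lm X Y \<boxtimes>\<^bsub>D\<^esub> idt D (ob U Z)) =
      lm X (Y \<otimes>\<^bsub>C\<^esub> Z) \<cdot>\<^bsub>D\<^esub> (idt D (ob U X) \<boxtimes>\<^bsub>D\<^esub> lm Y Z)"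
    and lam_unit_left: "A \<in> obj C \<Longrightarrow> lm (unt C) A \<cdot>\<^bsub>D\<^esub> (lu \<boxtimes>\<^bsub>D\<^esub> idt D (ob U A)) = idt D (ob U A)"
    and lam_unit_right: "A \<in> obj C \<Longrightarrow> lm A (unt C) \<cdot>\<^bsub>D\<^esub> (idt D (ob U A) \<boxtimes>\<^bsub>D\<^esub> lu) = idt D (ob U A)"

text \<open>A dual equivalence between \<open>C\<close> and \<open>C'\<close> consists of contravariant functors
  \<open>hat : C \<rightarrow> C'\<close> and \<open>bck : C' \<rightarrow> C\<close> and natural isomorphisms
  \<open>ui A : A \<rightarrow> bck (hat A)\<close> in \<open>C\<close> and \<open>uj X : X \<rightarrow> hat (bck X)\<close> in \<open>C'\<close>. Since
  double duals are identified with the original objects along these isomorphisms, they have to be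
  coherent, i.e. to satisfy the triangle identities (every equivalence can be so arranged).\<close>

record ('o, 'a, 'p, 'b) duality =
  hat :: "('o, 'a, 'p, 'b) ftr"
  bck :: "('p, 'b, 'o, 'a) ftr"
  ui :: "'o \<Rightarrow> 'a"
  uj :: "'p \<Rightarrow> 'b"

locale dual_equivalence =
  hat: is_functor "op_cat C" C' "hat P" + bck: is_functor "op_cat C'" C "bck P" +
  ui: nat_iso C C id_ftr "bck P \<odot> hat P" "ui P" +
  uj: nat_iso C' C' id_ftr "hat P \<odot> bck P" "uj P"
  for C :: "('o, 'a, 'y) cat_scheme" and C' :: "('p, 'b, 'z) cat_scheme"
    and P :: "('o, 'a, 'p, 'b) duality" +
  assumes triangle_hat:
      "A \<in> obj C \<Longrightarrow> ar (hat P) (ui P A) \<cdot>\<^bsub>C'\<^esub> uj P (ob (hat P) A) = idt C' (ob (hat P) A)"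
    and triangle_bck:
      "X \<in> obj C' \<Longrightarrow> ar (bck P) (uj P X) \<cdot>\<^bsub>C\<^esub> ui P (ob (bck P) X) = idt C (ob (bck P) X)"

text \<open>For \<open>G : A \<rightarrow> B\<close> with dualities \<open>P\<close> of \<open>A\<close> and \<open>Q\<close> of \<open>B\<close>.\<close>

definition dual_ftr ::
    "('o, 'a, 'p, 'b) duality \<Rightarrow> ('q, 'c, 'r, 'd) duality \<Rightarrow> ('o, 'a, 'q, 'c) ftr \<Rightarrow> ('p, 'b, 'r, 'd) ftr" where
  "dual_ftr P Q G = hat Q \<odot> G \<odot> bck P"

text \<open>The dual of \<open>\<phi> : G \<Rightarrow> H\<close> goes from the dual of \<open>H\<close> to the dual of \<open>G\<close>.\<close>

definition dual_nt ::
    "('o, 'a, 'p, 'b) duality \<Rightarrow> ('q, 'c, 'r, 'd) duality \<Rightarrow> ('o \<Rightarrow> 'c) \<Rightarrow> 'p \<Rightarrow> 'd" where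
  "dual_nt P Q \<phi> X = ar (hat Q) (\<phi> (ob (bck P) X))"

text \<open>The canonical isomorphism from the dual of \<open>G \<odot> H\<close> to the composite of the duals, for
  \<open>H : A \<rightarrow> B\<close>, \<open>G : B \<rightarrow> E\<close> and dualities \<open>P, Q, R\<close> of \<open>A, B, E\<close>.\<close>

definition dual_cmp ::
    "('p, 'b, 'z) cat_scheme \<Rightarrow> ('o, 'a, 'o', 'a') duality \<Rightarrow> ('p, 'b, 'p', 'b') duality \<Rightarrow>
     ('q, 'c, 'q', 'c') duality \<Rightarrow> ('p, 'b, 'q, 'c) ftr \<Rightarrow> ('o, 'a, 'p, 'b) ftr \<Rightarrow> 'o' \<Rightarrow> 'c'" where
  "dual_cmp B P Q R G H X = ar (hat R) (ar G (inva B (ui Q (ob H (ob (bck P) X)))))"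

text \<open>\<open>C'\<close> with the dual tensor \<open>X \<otimes> Y = hat (bck X \<otimes> bck Y)\<close>.\<close>

definition dual_moncat ::
    "('o, 'a, 'y) moncat_scheme \<Rightarrow> ('p, 'b, 'z) cat_scheme \<Rightarrow> ('o, 'a, 'p, 'b) duality \<Rightarrow> ('p, 'b) moncat" where
  "dual_moncat C C' P =
    \<lparr>obj = obj C', arr = arr C', src = src C', tgt = tgt C', idt = idt C', cmp = cmp C',
     tno = (\<lambda>X Y. ob (hat P) (ob (bck P) X \<otimes>\<^bsub>C\<^esub> ob (bck P) Y)),
     tna = (\<lambda>f g. ar (hat P) (ar (bck P) f \<boxtimes>\<^bsub>C\<^esub> ar (bck P) g)),
     unt = ob (hat P) (unt C)\<rparr>"

text \<open>The canonical isomorphism from the dual of \<open>A\<^sup>n\<close> to the \<open>n\<close>-th dual tensor power of the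
  dual of \<open>A\<close>.\<close>

fun dual_pow ::
    "('o, 'a, 'y) moncat_scheme \<Rightarrow> ('p, 'b, 'z) cat_scheme \<Rightarrow> ('o, 'a, 'p, 'b) duality \<Rightarrow> 'o \<Rightarrow> nat \<Rightarrow> 'b" where
  "dual_pow C C' P A 0 = idt C' (ob (hat P) (unt C))"
| "dual_pow C C' P A (Suc 0) = idt C' (ob (hat P) A)"
| "dual_pow C C' P A (Suc (Suc n)) = ar (hat P)
    (inva C (ui P A) \<boxtimes>\<^bsub>C\<^esub>
      (inva C (ui P (tpow C A (Suc n))) \<cdot>\<^bsub>C\<^esub> ar (bck P) (dual_pow C C' P A (Suc n))))"

record ('c, 'ca, 'd, 'da, 'x, 'xa, 'y, 'ya) setting =
  CC :: "('c, 'ca) moncat"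
  DD :: "('d, 'da) moncat"
  CH :: "('x, 'xa) cat"
  DH :: "('y, 'ya) cat"
  duC :: "('c, 'ca, 'x, 'xa) duality"
  duD :: "('d, 'da, 'y, 'ya) duality"
  FF :: "('d, 'da, 'c, 'ca) ftr"
  UU :: "('c, 'ca, 'd, 'da) ftr"
  eta :: "'d \<Rightarrow> 'da"
  eps :: "'c \<Rightarrow> 'ca"
  lam :: "'c \<Rightarrow> 'c \<Rightarrow> 'da"
  lam0 :: "'da"

locale monoidal_adjunction_duality =
  fixes S :: "('c, 'ca, 'd, 'da, 'x, 'xa, 'y, 'ya) setting"
  assumes C_mon: "strict_monoidal_category (CC S)"
    and D_mon: "strict_monoidal_category (DD S)"
    and C_dual: "dual_equivalence (CC S) (CH S) (duC S)"
    and D_dual: "dual_equivalence (DD S) (DH S) (duD S)"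
    and adj: "adjunction (DD S) (CC S) (FF S) (UU S) (eta S) (eps S)"
    and U_strong: "strong_monoidal_functor (CC S) (DD S) (UU S) (lam S) (lam0 S)"

text \<open>\<open>CM S\<close> is the dual category of \<open>CC S\<close> equipped with the dual tensor.\<close>

definition CM :: "('c, 'ca, 'd, 'da, 'x, 'xa, 'y, 'ya) setting \<Rightarrow> ('x, 'xa) moncat" where
  "CM S = dual_moncat (CC S) (CH S) (duC S)"

definition Fhat :: "('c, 'ca, 'd, 'da, 'x, 'xa, 'y, 'ya) setting \<Rightarrow> ('y, 'ya, 'x, 'xa) ftr" where
  "Fhat S = dual_ftr (duD S) (duC S) (FF S)"

definition Uhat :: "('c, 'ca, 'd, 'da, 'x, 'xa, 'y, 'ya) setting \<Rightarrow> ('x, 'xa, 'y, 'ya) ftr" where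
  "Uhat S = dual_ftr (duC S) (duD S) (UU S)"

definition TT :: "('c, 'ca, 'd, 'da, 'x, 'xa, 'y, 'ya) setting \<Rightarrow> ('x, 'xa, 'x, 'xa) ftr" where
  "TT S = Fhat S \<odot> Uhat S"

text \<open>The canonical isomorphisms from the dual of \<open>FU\<close> to \<open>T\<close> and from the dual of \<open>UF\<close> to
  \<open>Uhat \<odot> Fhat\<close>.\<close>

definition dFU :: "('c, 'ca, 'd, 'da, 'x, 'xa, 'y, 'ya) setting \<Rightarrow> 'x \<Rightarrow> 'xa" where
  "dFU S = dual_cmp (DD S) (duC S) (duD S) (duC S) (FF S) (UU S)"

definition dUF :: "('c, 'ca, 'd, 'da, 'x, 'xa, 'y, 'ya) setting \<Rightarrow> 'y \<Rightarrow> 'ya" where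
  "dUF S = dual_cmp (CC S) (duD S) (duC S) (duD S) (UU S) (FF S)"

text \<open>The unit \<open>e\<close> is the dual of \<open>\<epsilon>\<close>, from the dual of the identity functor (isomorphic to the
  identity via \<open>uj\<close>) to the dual of \<open>FU\<close> (isomorphic to \<open>T\<close>); similarly for the dual of \<open>\<eta>\<close>.\<close>

definition T_unit :: "('c, 'ca, 'd, 'da, 'x, 'xa, 'y, 'ya) setting \<Rightarrow> 'x \<Rightarrow> 'xa" where
  "T_unit S X = dFU S X \<cdot>\<^bsub>CH S\<^esub> dual_nt (duC S) (duC S) (eps S) X \<cdot>\<^bsub>CH S\<^esub> uj (duC S) X"

definition eta_hat :: "('c, 'ca, 'd, 'da, 'x, 'xa, 'y, 'ya) setting \<Rightarrow> 'y \<Rightarrow> 'ya" where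
  "eta_hat S Y = inva (DH S) (uj (duD S) Y) \<cdot>\<^bsub>DH S\<^esub> dual_nt (duD S) (duD S) (eta S) Y
     \<cdot>\<^bsub>DH S\<^esub> inva (DH S) (dUF S Y)"

definition T_mult :: "('c, 'ca, 'd, 'da, 'x, 'xa, 'y, 'ya) setting \<Rightarrow> 'x \<Rightarrow> 'xa" where
  "T_mult S X = ar (Fhat S) (eta_hat S (ob (Uhat S) X))"

definition delta :: "('c, 'ca, 'd, 'da, 'x, 'xa, 'y, 'ya) setting \<Rightarrow> 'c \<Rightarrow> 'c \<Rightarrow> 'ca" where
  "delta S A B =
     eps S (ob (FF S) (ob (UU S) A) \<otimes>\<^bsub>CC S\<^esub> ob (FF S) (ob (UU S) B))
     \<cdot>\<^bsub>CC S\<^esub> ar (FF S) (lam S (ob (FF S) (ob (UU S) A)) (ob (FF S) (ob (UU S) B)))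
     \<cdot>\<^bsub>CC S\<^esub> ar (FF S) (eta S (ob (UU S) A) \<boxtimes>\<^bsub>DD S\<^esub> eta S (ob (UU S) B))
     \<cdot>\<^bsub>CC S\<^esub> ar (FF S) (inva (DD S) (lam S A B))"

text \<open>The dual of \<open>\<delta>\<close>, written out with the canonical isomorphisms: with
  \<open>A = bck X\<close>, \<open>B = bck Y\<close> it is the composite
  \<open>TX \<otimes> TY \<rightarrow> hat (FUA) \<otimes> hat (FUB) \<rightarrow> hat (FUA \<otimes> FUB) \<rightarrow> hat (FU(A \<otimes> B)) \<rightarrow>
    hat (FU (bck (X \<otimes> Y))) \<rightarrow> T(X \<otimes> Y)\<close>.\<close>

definition delta_hat :: "('c, 'ca, 'd, 'da, 'x, 'xa, 'y, 'ya) setting \<Rightarrow> 'x \<Rightarrow> 'x \<Rightarrow> 'xa" where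
  "delta_hat S X Y = (let
     h = hat (duC S); i = ui (duC S); FU = FF S \<odot> UU S;
     A = ob (bck (duC S)) X; B = ob (bck (duC S)) Y in
     dFU S (X \<otimes>\<^bsub>CM S\<^esub> Y)
     \<cdot>\<^bsub>CH S\<^esub> ar h (ar FU (inva (CC S) (i (A \<otimes>\<^bsub>CC S\<^esub> B))))
     \<cdot>\<^bsub>CH S\<^esub> ar h (delta S A B)
     \<cdot>\<^bsub>CH S\<^esub> ar h (i (ob FU A) \<boxtimes>\<^bsub>CC S\<^esub> i (ob FU B))
     \<cdot>\<^bsub>CH S\<^esub> (inva (CH S) (dFU S X) \<boxtimes>\<^bsub>CM S\<^esub> inva (CH S) (dFU S Y)))"

fun lamn :: "('c, 'ca, 'd, 'da, 'x, 'xa, 'y, 'ya) setting \<Rightarrow> 'c \<Rightarrow> nat \<Rightarrow> 'da" where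
  "lamn S A 0 = lam0 S"
| "lamn S A (Suc 0) = idt (DD S) (ob (UU S) A)"
| "lamn S A (Suc (Suc n)) = lam S A (tpow (CC S) A (Suc n))
     \<cdot>\<^bsub>DD S\<^esub> (idt (DD S) (ob (UU S) A) \<boxtimes>\<^bsub>DD S\<^esub> lamn S A (Suc n))"

definition U_operator ::
    "('c, 'ca, 'd, 'da, 'x, 'xa, 'y, 'ya) setting \<Rightarrow> 'c \<Rightarrow> nat \<Rightarrow> nat \<Rightarrow> 'da \<Rightarrow> bool" where
  "U_operator S A k n a \<longleftrightarrow> A \<in> obj (CC S) \<and>
     a \<in> hom (DD S) (tpow (DD S) (ob (UU S) A) k) (tpow (DD S) (ob (UU S) A) n)"

definition operator_transpose ::
    "('c, 'ca, 'd, 'da, 'x, 'xa, 'y, 'ya) setting \<Rightarrow> 'c \<Rightarrow> nat \<Rightarrow> nat \<Rightarrow> 'da \<Rightarrow> 'ca" where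
  "operator_transpose S A k n a = eps S (tpow (CC S) A n)
     \<cdot>\<^bsub>CC S\<^esub> ar (FF S) (lamn S A n \<cdot>\<^bsub>DD S\<^esub> a \<cdot>\<^bsub>DD S\<^esub> inva (DD S) (lamn S A k))"

text \<open>Writing \<open>A'\<close> for the dual of \<open>A\<close> and \<open>\<alpha>\<close> for the transpose \<open>FU(A\<^sup>k) \<rightarrow> A\<^sup>n\<close>, the dual
  operator is \<open>A'\<^sup>n \<rightarrow> hat (A\<^sup>n) \<rightarrow> hat (FU(A\<^sup>k)) \<rightarrow> hat (FU (bck (hat (A\<^sup>k)))) \<rightarrow>
  T (hat (A\<^sup>k)) \<rightarrow> T (A'\<^sup>k)\<close>, where the second arrow is \<open>hat \<alpha>\<close> and the others are the canonical
  isomorphisms.\<close>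

definition operator_dual ::
    "('c, 'ca, 'd, 'da, 'x, 'xa, 'y, 'ya) setting \<Rightarrow> 'c \<Rightarrow> nat \<Rightarrow> nat \<Rightarrow> 'da \<Rightarrow> 'xa" where
  "operator_dual S A k n a = (let
     h = hat (duC S); FU = FF S \<odot> UU S; Ak = tpow (CC S) A k;
     pw = dual_pow (CC S) (CH S) (duC S) A in
     ar (TT S) (pw k)
     \<cdot>\<^bsub>CH S\<^esub> dFU S (ob h Ak)
     \<cdot>\<^bsub>CH S\<^esub> ar h (ar FU (inva (CC S) (ui (duC S) Ak)))
     \<cdot>\<^bsub>CH S\<^esub> ar h (operator_transpose S A k n a)
     \<cdot>\<^bsub>CH S\<^esub> inva (CH S) (pw n))"

definition is_dual_operator ::
    "('c, 'ca, 'd, 'da, 'x, 'xa, 'y, 'ya) setting \<Rightarrow> 'c \<Rightarrow> nat \<Rightarrow> nat \<Rightarrow> 'da \<Rightarrow> 'xa \<Rightarrow> bool" where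
  "is_dual_operator S A k n a r \<longleftrightarrow> U_operator S A k n a \<and>
     r \<in> hom (CH S) (tpow (CM S) (ob (hat (duC S)) A) n)
           (ob (TT S) (tpow (CM S) (ob (hat (duC S)) A) k)) \<and>
     r = operator_dual S A k n a"

end

theory Submission
  imports Defs
begin

text \<open>Every arrow of the dual category that occurs is the hat of an arrow of \<open>C\<close>, once the canonical
  isomorphisms are collected into \<open>q\<^sub>Z : (U Z'')'' \<rightarrow> U Z\<close> (below \<open>dd_U Z\<close>), where \<open>''\<close> is the
  double dual. In these terms the dual of \<open>a : UA \<rightarrow> UA\<close> is the hat of the transpose of
  \<open>a \<cdot> q\<^sub>A\<close>, \<open>T\<close> sends the hat of \<open>f\<close> to the hat of \<open>F\<close> applied to \<open>q\<^sup>-\<^sup>1 \<cdot> U f \<cdot> q\<close>, and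
  \<open>m\<close> is the hat of \<open>F (q\<^sup>-\<^sup>1 \<cdot> \<eta>)\<close>. The three claims then become identities about transposes:
  naturality of \<open>\<epsilon>\<close>, a triangle identity, and the fact that composing \<open>\<delta>\<close> with a tensor
  product of two transposes gives the transpose of their tensor product.\<close>

context category
begin

lemma arr_hom: "f \<in> arr C \<Longrightarrow> f \<in> hom C (src C f) (tgt C f)"
  by (simp add: hom_def)

lemma cmp_arr [simp]:
  assumes "f \<in> arr C" "g \<in> arr C" "tgt C f = src C g"
  shows "g \<cdot> f \<in> arr C" "src C (g \<cdot> f) = src C f" "tgt C (g \<cdot> f) = tgt C g"
  using cmp_hom[of f "src C f" "tgt C f" g "tgt C g"] assms by (auto simp: hom_def)

lemma cmp_assoc_arr [simp]:
  assumes "f \<in> arr C" "g \<in> arr C" "k \<in> arr C" "tgt C f = src C g" "tgt C g = src C k"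
  shows "(k \<cdot> g) \<cdot> f = k \<cdot> (g \<cdot> f)"
  using cmp_assoc[of f "src C f" "tgt C f" g "tgt C g" k "tgt C k"] assms by (simp add: hom_def)

lemma idt_arr [simp]:
  assumes "A \<in> obj C"
  shows "idt C A \<in> arr C" "src C (idt C A) = A" "tgt C (idt C A) = A"
  using idt_hom[OF assms] by (auto simp: hom_def)

lemma cmp_idt [simp]:
  assumes "f \<in> arr C"
  shows "tgt C f = A \<Longrightarrow> idt C A \<cdot> f = f" "src C f = A \<Longrightarrow> f \<cdot> idt C A = f"
  using idt_left idt_right arr_hom[OF assms] by auto

lemma src_tgt_obj [simp]:
  assumes "f \<in> arr C" shows "src C f \<in> obj C" "tgt C f \<in> obj C"
  using assms src_obj tgt_obj by auto

lemma inva_eq: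
  assumes "inverse_arrows C f g"
  shows "inva C f = g"
  unfolding inva_def
proof (rule the_equality)
  fix k
  assume k: "inverse_arrows C f k"
  have "k = k \<cdot> (f \<cdot> g)"
    using assms k by (simp add: inverse_arrows_def hom_def)
  also have "\<dots> = (k \<cdot> f) \<cdot> g"
    using assms k by (subst cmp_assoc_arr) (auto simp: inverse_arrows_def hom_def)
  also have "\<dots> = g"
    using assms k by (simp add: inverse_arrows_def hom_def)
  finally show "k = g" .
qed (rule assms)

lemma inverse_inva:
  assumes "iso C f" shows "inverse_arrows C f (inva C f)"
  using assms inva_eq unfolding iso_def by metis

lemma inva_arr [simp]:
  assumes "iso C f"
  shows "inva C f \<in> arr C" "src C (inva C f) = tgt C f" "tgt C (inva C f) = src C f"
    "inva C f \<cdot> f = idt C (src C f)" "f \<cdot> inva C f = idt C (tgt C f)"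
  using inverse_inva[OF assms] by (auto simp: inverse_arrows_def hom_def)

lemma iso_arr: "iso C f \<Longrightarrow> f \<in> arr C"
  by (auto simp: iso_def inverse_arrows_def)

lemma inva_cancel [simp]:
  assumes "iso C f" "x \<in> arr C"
  shows "tgt C x = src C f \<Longrightarrow> inva C f \<cdot> (f \<cdot> x) = x"
    "tgt C x = tgt C f \<Longrightarrow> f \<cdot> (inva C f \<cdot> x) = x"
  using assms iso_arr[OF assms(1)] by (simp_all flip: cmp_assoc_arr)

lemma inva_idt [simp]: "A \<in> obj C \<Longrightarrow> inva C (idt C A) = idt C A"
  by (rule inva_eq) (simp add: inverse_arrows_def hom_def)

lemma iso_inva [simp]: "iso C f \<Longrightarrow> iso C (inva C f)"
  unfolding iso_def[of C "inva C f"]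
  by (rule exI[of _ f]) (auto simp: inverse_arrows_def hom_def iso_arr)

lemma inva_inva [simp]: "iso C f \<Longrightarrow> inva C (inva C f) = f"
  by (rule inva_eq) (auto simp: inverse_arrows_def hom_def iso_arr)

lemma inverse_arrows_cmp:
  assumes "iso C f" "iso C g" "tgt C f = src C g"
  shows "inverse_arrows C (g \<cdot> f) (inva C f \<cdot> inva C g)"
  using assms by (simp add: inverse_arrows_def hom_def iso_arr)

lemma iso_cmp [simp]: "\<lbrakk>iso C f; iso C g; tgt C f = src C g\<rbrakk> \<Longrightarrow> iso C (g \<cdot> f)"
  unfolding iso_def[of C "g \<cdot> f"] by (rule exI, rule inverse_arrows_cmp)

lemma inva_cmp: "\<lbrakk>iso C f; iso C g; tgt C f = src C g\<rbrakk> \<Longrightarrow> inva C (g \<cdot> f) = inva C f \<cdot> inva C g"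
  by (rule inva_eq[OF inverse_arrows_cmp])

end

context is_functor
begin

lemma ar_arr [simp]:
  assumes "f \<in> arr A"
  shows "ar F f \<in> arr B" "src B (ar F f) = ob F (src A f)" "tgt B (ar F f) = ob F (tgt A f)"
  using ar_hom[OF A.arr_hom[OF assms]] by (auto simp: hom_def)

lemma ar_cmp_arr:
  assumes "f \<in> arr A" "g \<in> arr A" "tgt A f = src A g"
  shows "ar F (g \<cdot>\<^bsub>A\<^esub> f) = ar F g \<cdot>\<^bsub>B\<^esub> ar F f"
  using ar_cmp[of f "src A f" "tgt A f" g "tgt A g"] assms by (simp add: hom_def)

lemma inverse_arrows_ar:
  assumes "iso A f"
  shows "inverse_arrows B (ar F f) (ar F (inva A f))"
  using assms A.iso_arr[OF assms]
  by (simp add: inverse_arrows_def hom_def ar_idt flip: ar_cmp_arr)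

lemma iso_ar [simp]: "iso A f \<Longrightarrow> iso B (ar F f)"
  unfolding iso_def[of B] by (rule exI, erule inverse_arrows_ar)

lemma inva_ar: "iso A f \<Longrightarrow> inva B (ar F f) = ar F (inva A f)"
  by (rule B.inva_eq[OF inverse_arrows_ar])

end

lemma op_cat_simps [simp]:
  "obj (op_cat C) = obj C" "arr (op_cat C) = arr C" "src (op_cat C) = tgt C" "tgt (op_cat C) = src C"
  "idt (op_cat C) = idt C" "g \<cdot>\<^bsub>op_cat C\<^esub> f = f \<cdot>\<^bsub>C\<^esub> g"
  by (simp_all add: op_cat_def)

lemma inverse_arrows_op_cat:
  "inverse_arrows (op_cat C) f g \<longleftrightarrow> inverse_arrows C f g"
  by (auto simp: inverse_arrows_def hom_def)

lemma iso_op_cat [simp]: "iso (op_cat C) f \<longleftrightarrow> iso C f"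
  by (simp add: iso_def inverse_arrows_op_cat)

lemma inva_op_cat [simp]: "inva (op_cat C) f = inva C f"
  by (simp add: inva_def inverse_arrows_op_cat)

lemma ftr_simps [simp]:
  "ob id_ftr X = X" "ar id_ftr f = f"
  "ob (G \<odot> F) X = ob G (ob F X)" "ar (G \<odot> F) f = ar G (ar F f)"
  by (simp_all add: id_ftr_def comp_ftr_def)

context nat_trans
begin

lemma component_arr [simp]:
  assumes "X \<in> obj A"
  shows "\<phi> X \<in> arr B" "src B (\<phi> X) = ob G X" "tgt B (\<phi> X) = ob H X"
  using component_hom[OF assms] by (auto simp: hom_def)

lemma naturality_arr:
  assumes "f \<in> arr A" shows "\<phi> (tgt A f) \<cdot>\<^bsub>B\<^esub> ar G f = ar H f \<cdot>\<^bsub>B\<^esub> \<phi> (src A f)"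
  using naturality assms by (simp add: hom_def)

end

context dual_equivalence
begin

lemmas ui_iso = ui.component_iso

lemma hat_cmp:
  assumes "f \<in> arr C" "g \<in> arr C" "tgt C f = src C g"
  shows "ar (hat P) (g \<cdot>\<^bsub>C\<^esub> f) = ar (hat P) f \<cdot>\<^bsub>C'\<^esub> ar (hat P) g"
  using hat.ar_cmp_arr[of g f] assms by simp

lemma bck_hat_ar:
  assumes "f \<in> arr C"
  shows "ar (bck P) (ar (hat P) f) = ui P (tgt C f) \<cdot>\<^bsub>C\<^esub> (f \<cdot>\<^bsub>C\<^esub> inva C (ui P (src C f)))"
proof -
  have "ar (bck P) (ar (hat P) f)
      = (ar (bck P) (ar (hat P) f) \<cdot>\<^bsub>C\<^esub> ui P (src C f)) \<cdot>\<^bsub>C\<^esub> inva C (ui P (src C f))"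
    using assms by (simp add: ui_iso)
  also have "\<dots> = (ui P (tgt C f) \<cdot>\<^bsub>C\<^esub> f) \<cdot>\<^bsub>C\<^esub> inva C (ui P (src C f))"
    using ui.naturality_arr[OF assms] by simp
  finally show ?thesis
    using assms by (simp add: ui_iso)
qed

lemma uj_hat:
  assumes "A \<in> obj C"
  shows "uj P (ob (hat P) A) = ar (hat P) (inva C (ui P A))"
proof -
  have "uj P (ob (hat P) A)
      = ar (hat P) (inva C (ui P A)) \<cdot>\<^bsub>C'\<^esub> (ar (hat P) (ui P A) \<cdot>\<^bsub>C'\<^esub> uj P (ob (hat P) A))"
    using assms hat.B.inva_cancel(1)[OF hat.iso_ar, of "ui P A" "uj P (ob (hat P) A)"]
    by (simp add: ui_iso hat.inva_ar hat.ob_obj)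
  also have "\<dots> = ar (hat P) (inva C (ui P A))"
    using assms by (simp add: triangle_hat ui_iso)
  finally show ?thesis .
qed

end

context strict_monoidal_category
begin

lemma tna_arr [simp]:
  assumes "f \<in> arr C" "g \<in> arr C"
  shows "f \<boxtimes> g \<in> arr C" "src C (f \<boxtimes> g) = src C f \<otimes> src C g" "tgt C (f \<boxtimes> g) = tgt C f \<otimes> tgt C g"
  using tna_hom[OF arr_hom arr_hom, OF assms] by (auto simp: hom_def)

lemma tna_cmp_arr:
  assumes "f \<in> arr C" "f' \<in> arr C" "g \<in> arr C" "g' \<in> arr C"
    "tgt C f = src C f'" "tgt C g = src C g'"
  shows "(f' \<boxtimes> g') \<cdot> (f \<boxtimes> g) = (f' \<cdot> f) \<boxtimes> (g' \<cdot> g)"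
  using tna_cmp[of f "src C f" "tgt C f" f' "tgt C f'" g "src C g" "tgt C g" g' "tgt C g'"] assms
  by (simp add: hom_def)

lemma inverse_arrows_tna:
  assumes "iso C f" "iso C g"
  shows "inverse_arrows C (f \<boxtimes> g) (inva C f \<boxtimes> inva C g)"
  using assms by (simp add: inverse_arrows_def hom_def iso_arr tna_cmp_arr tna_idt)

lemma iso_tna [simp]: "\<lbrakk>iso C f; iso C g\<rbrakk> \<Longrightarrow> iso C (f \<boxtimes> g)"
  unfolding iso_def[of C "f \<boxtimes> g"] by (rule exI, rule inverse_arrows_tna)

lemma inva_tna: "\<lbrakk>iso C f; iso C g\<rbrakk> \<Longrightarrow> inva C (f \<boxtimes> g) = inva C f \<boxtimes> inva C g"
  by (rule inva_eq[OF inverse_arrows_tna])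

end

context monoidal_adjunction_duality
begin

abbreviation "C \<equiv> CC S"
abbreviation "D \<equiv> DD S"
abbreviation "C' \<equiv> CH S"
abbreviation "Fo \<equiv> ob (FF S)"
abbreviation "Fa \<equiv> ar (FF S)"
abbreviation "Uo \<equiv> ob (UU S)"
abbreviation "Ua \<equiv> ar (UU S)"
abbreviation "ho \<equiv> ob (hat (duC S))"
abbreviation "ha \<equiv> ar (hat (duC S))"
abbreviation "bo \<equiv> ob (bck (duC S))"
abbreviation "ba \<equiv> ar (bck (duC S))"
abbreviation "ddD Y \<equiv> ob (bck (duD S)) (ob (hat (duD S)) Y)"

sublocale C: strict_monoidal_category C by (rule C_mon)
sublocale D: strict_monoidal_category D by (rule D_mon)
sublocale dC: dual_equivalence C C' "duC S" by (rule C_dual)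
sublocale dD: dual_equivalence D "DH S" "duD S" by (rule D_dual)
sublocale adj: adjunction D C "FF S" "UU S" "eta S" "eps S" by (rule adj)
sublocale U: strong_monoidal_functor C D "UU S" "lam S" "lam0 S" by (rule U_strong)

definition dd_U where
  "dd_U Z = Ua (inva C (ui (duC S) Z)) \<cdot>\<^bsub>D\<^esub> inva D (ui (duD S) (Uo (bo (ho Z))))"

lemmas obj_simps [simp] =
  adj.F.ob_obj adj.U.ob_obj C.tno_obj D.tno_obj
  dC.hat.ob_obj[simplified] dC.bck.ob_obj[simplified] dD.hat.ob_obj[simplified] dD.bck.ob_obj[simplified]

lemmas iso_simps [simp] = dC.ui_iso dD.ui_iso

lemma dd_U_iso [simp]: "Z \<in> obj C \<Longrightarrow> iso D (dd_U Z)"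
  by (simp add: dd_U_def)

lemma dd_U_arr [simp]:
  assumes "Z \<in> obj C"
  shows "dd_U Z \<in> arr D" "src D (dd_U Z) = ddD (Uo (bo (ho Z)))" "tgt D (dd_U Z) = Uo Z"
  using assms by (simp_all add: dd_U_def)

lemma inva_dd_U:
  assumes "Z \<in> obj C"
  shows "inva D (dd_U Z) = ui (duD S) (Uo (bo (ho Z))) \<cdot>\<^bsub>D\<^esub> Ua (ui (duC S) Z)"
  using assms by (simp add: dd_U_def D.inva_cmp adj.U.inva_ar)

lemma dFU_eq: "dFU S X = ha (Fa (inva D (ui (duD S) (Uo (bo X)))))"
  by (simp add: dFU_def dual_cmp_def)

lemma TT_ob [simp]: "ob (TT S) X = ho (Fo (ddD (Uo (bo X))))"
  by (simp add: TT_def Fhat_def Uhat_def dual_ftr_def)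

lemma dFU_hat:
  assumes "Z \<in> obj C"
  shows "dFU S (ho Z) \<cdot>\<^bsub>C'\<^esub> ha (Fa (Ua (inva C (ui (duC S) Z)))) = ha (Fa (dd_U Z))"
  using assms by (simp add: dFU_eq dd_U_def dC.hat_cmp adj.F.ar_cmp_arr)

lemma TT_hat:
  assumes "f \<in> arr C"
  shows "ar (TT S) (ha f) = ha (Fa (inva D (dd_U (tgt C f)) \<cdot>\<^bsub>D\<^esub> Ua f \<cdot>\<^bsub>D\<^esub> dd_U (src C f)))"
  using assms
  by (simp add: TT_def Fhat_def Uhat_def dual_ftr_def dC.bck_hat_ar dD.bck_hat_ar
      inva_dd_U dd_U_def[of "src C f"] adj.U.ar_cmp_arr)

lemma eps_nat:
  assumes "f \<in> arr C"
  shows "eps S (tgt C f) \<cdot>\<^bsub>C\<^esub> Fa (Ua f) = f \<cdot>\<^bsub>C\<^esub> eps S (src C f)"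
  using adj.counit.naturality_arr[OF assms] by simp

lemma eta_nat:
  assumes "f \<in> arr D"
  shows "eta S (tgt D f) \<cdot>\<^bsub>D\<^esub> f = Ua (Fa f) \<cdot>\<^bsub>D\<^esub> eta S (src D f)"
  using adj.unit.naturality_arr[OF assms] by simp

lemma transpose_transpose:
  assumes "Z \<in> obj C" "u \<in> arr D" "tgt D u = Uo Z"
  shows "Ua (eps S Z \<cdot>\<^bsub>C\<^esub> Fa u) \<cdot>\<^bsub>D\<^esub> eta S (src D u) = u"
proof -
  have "Ua (eps S Z \<cdot>\<^bsub>C\<^esub> Fa u) \<cdot>\<^bsub>D\<^esub> eta S (src D u)
      = (Ua (eps S Z) \<cdot>\<^bsub>D\<^esub> eta S (Uo Z)) \<cdot>\<^bsub>D\<^esub> u"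
    using assms eta_nat[of u] by (simp add: adj.U.ar_cmp_arr)
  also have "\<dots> = u"
    using assms by (simp only: adj.triangle_U) simp
  finally show ?thesis .
qed

lemma operator_dual_1:
  assumes "A \<in> obj C" "a \<in> hom D (Uo A) (Uo A)"
  shows "operator_dual S A 1 1 a = ha (eps S A \<cdot>\<^bsub>C\<^esub> Fa (a \<cdot>\<^bsub>D\<^esub> dd_U A))"
proof -
  have a: "a \<in> arr D" "src D a = Uo A" "tgt D a = Uo A"
    using assms(2) by (auto simp: hom_def)
  have "operator_dual S A 1 1 a = dFU S (ho A) \<cdot>\<^bsub>C'\<^esub> ha (Fa (Ua (inva C (ui (duC S) A))))
      \<cdot>\<^bsub>C'\<^esub> ha (eps S A \<cdot>\<^bsub>C\<^esub> Fa a)"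
    using assms a
    by (simp add: operator_dual_def Let_def operator_transpose_def TT_def Fhat_def Uhat_def dual_ftr_def
       dC.hat.ar_idt[simplified] dC.bck.ar_idt[simplified] dD.hat.ar_idt[simplified]
       dD.bck.ar_idt[simplified] adj.F.ar_idt adj.U.ar_idt dFU_eq)
  also have "\<dots> = ha (Fa (dd_U A)) \<cdot>\<^bsub>C'\<^esub> ha (eps S A \<cdot>\<^bsub>C\<^esub> Fa a)"
    using assms by (simp add: dFU_hat)
  also have "\<dots> = ha (eps S A \<cdot>\<^bsub>C\<^esub> Fa (a \<cdot>\<^bsub>D\<^esub> dd_U A))"
    using assms a by (simp add: adj.F.ar_cmp_arr flip: dC.hat_cmp)
  finally show ?thesis .
qed

lemma eta_hat_hat:
  assumes "Y \<in> obj D"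
  shows "eta_hat S (ob (hat (duD S)) Y) = ar (hat (duD S))
    (Ua (ui (duC S) (Fo (ddD Y))) \<cdot>\<^bsub>D\<^esub> (eta S (ddD Y) \<cdot>\<^bsub>D\<^esub> ui (duD S) Y))"
  using assms
  by (simp add: eta_hat_def dUF_def dual_cmp_def dual_nt_def dD.uj_hat dD.hat.inva_ar adj.U.inva_ar
      dD.hat_cmp)

lemma T_mult_hat:
  assumes "A \<in> obj C"
  defines "W \<equiv> ddD (Uo (bo (ho A)))"
  shows "T_mult S (ho A) = ha (Fa (inva D (dd_U (Fo W)) \<cdot>\<^bsub>D\<^esub> eta S W))"
  using assms
  by (simp add: T_mult_def Fhat_def Uhat_def dual_ftr_def eta_hat_hat dD.bck_hat_ar inva_dd_U)

lemma operator_dual_cmp: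
  assumes A: "A \<in> obj C" and h: "h \<in> hom D (Uo A) (Uo A)" and g: "g \<in> hom D (Uo A) (Uo A)"
  shows "T_mult S (ho A) \<cdot>\<^bsub>C'\<^esub> ar (TT S) (operator_dual S A 1 1 h) \<cdot>\<^bsub>C'\<^esub> operator_dual S A 1 1 g
    = operator_dual S A 1 1 (g \<cdot>\<^bsub>D\<^esub> h)"
proof -
  define W where "W = ddD (Uo (bo (ho A)))"
  define r where "r = eps S A \<cdot>\<^bsub>C\<^esub> Fa (h \<cdot>\<^bsub>D\<^esub> dd_U A)"
  have [simp]: "h \<in> arr D" "src D h = Uo A" "tgt D h = Uo A"
    "g \<in> arr D" "src D g = Uo A" "tgt D g = Uo A"
    using h g by (auto simp: hom_def)
  have W [simp]: "W \<in> obj D" "src D (dd_U A) = W"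
    using A by (simp_all add: W_def)
  have r [simp]: "r \<in> arr C" "src C r = Fo W" "tgt C r = A"
    using A by (simp_all add: r_def)
  have transpose: "Ua r \<cdot>\<^bsub>D\<^esub> eta S W = h \<cdot>\<^bsub>D\<^esub> dd_U A"
    using A transpose_transpose[of A "h \<cdot>\<^bsub>D\<^esub> dd_U A"] by (simp add: r_def)
  have "T_mult S (ho A) \<cdot>\<^bsub>C'\<^esub> ar (TT S) (operator_dual S A 1 1 h) \<cdot>\<^bsub>C'\<^esub> operator_dual S A 1 1 g
    = ha (Fa (inva D (dd_U (Fo W)) \<cdot>\<^bsub>D\<^esub> eta S W))
      \<cdot>\<^bsub>C'\<^esub> ha (Fa (inva D (dd_U A) \<cdot>\<^bsub>D\<^esub> Ua r \<cdot>\<^bsub>D\<^esub> dd_U (Fo W)))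
      \<cdot>\<^bsub>C'\<^esub> ha (eps S A \<cdot>\<^bsub>C\<^esub> Fa (g \<cdot>\<^bsub>D\<^esub> dd_U A))"
    using A h g r by (simp only: operator_dual_1 T_mult_hat TT_hat W_def flip: r_def)
  also have "\<dots> = ha (eps S A \<cdot>\<^bsub>C\<^esub> Fa (g \<cdot>\<^bsub>D\<^esub> (Ua r \<cdot>\<^bsub>D\<^esub> eta S W)))"
    using A by (simp flip: dC.hat_cmp adj.F.ar_cmp_arr)
  also have "\<dots> = operator_dual S A 1 1 (g \<cdot>\<^bsub>D\<^esub> h)"
    unfolding transpose using A h g by (simp add: operator_dual_1[simplified] D.cmp_hom)
  finally show ?thesis .
qed

lemma operator_dual_idt:
  assumes A: "A \<in> obj C"
  shows "T_unit S (ho A) = operator_dual S A 1 1 (idt D (Uo A))"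
proof -
  let ?j = "inva C (ui (duC S) A)"
  have "T_unit S (ho A) = dFU S (ho A) \<cdot>\<^bsub>C'\<^esub> ha (?j \<cdot>\<^bsub>C\<^esub> eps S (bo (ho A)))"
    using A by (simp add: T_unit_def dual_nt_def dC.uj_hat dFU_eq dC.hat_cmp)
  also have "?j \<cdot>\<^bsub>C\<^esub> eps S (bo (ho A)) = eps S A \<cdot>\<^bsub>C\<^esub> Fa (Ua ?j)"
    using A eps_nat[of ?j] by simp
  also have "dFU S (ho A) \<cdot>\<^bsub>C'\<^esub> ha (eps S A \<cdot>\<^bsub>C\<^esub> Fa (Ua ?j))
      = (dFU S (ho A) \<cdot>\<^bsub>C'\<^esub> ha (Fa (Ua ?j))) \<cdot>\<^bsub>C'\<^esub> ha (eps S A)"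
    using A by (simp add: dFU_eq dC.hat_cmp)
  also have "\<dots> = operator_dual S A 1 1 (idt D (Uo A))"
    using A by (simp add: dFU_hat operator_dual_1[simplified] D.idt_hom dC.hat_cmp)
  finally show ?thesis .
qed

lemma CM_simps [simp]:
  "tno (CM S) X Y = ho (bo X \<otimes>\<^bsub>C\<^esub> bo Y)" "tna (CM S) x y = ha (ba x \<boxtimes>\<^bsub>C\<^esub> ba y)"
  by (simp_all add: CM_def dual_moncat_def)

lemma lam_simps [simp]:
  assumes "X \<in> obj C" "Y \<in> obj C"
  shows "iso D (lam S X Y)" "lam S X Y \<in> arr D"
    "src D (lam S X Y) = Uo X \<otimes>\<^bsub>D\<^esub> Uo Y" "tgt D (lam S X Y) = Uo (X \<otimes>\<^bsub>C\<^esub> Y)"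
  using U.lam_hom[OF assms] U.lam_iso[OF assms] by (auto simp: hom_def)

lemma lam_nat:
  assumes "f \<in> arr C" "g \<in> arr C"
  shows "lam S (tgt C f) (tgt C g) \<cdot>\<^bsub>D\<^esub> (Ua f \<boxtimes>\<^bsub>D\<^esub> Ua g) =
    Ua (f \<boxtimes>\<^bsub>C\<^esub> g) \<cdot>\<^bsub>D\<^esub> lam S (src C f) (src C g)"
  using U.lam_natural C.arr_hom assms by blast

lemma inva_lam_nat:
  assumes "f \<in> arr C" "g \<in> arr C"
  shows "inva D (lam S (tgt C f) (tgt C g)) \<cdot>\<^bsub>D\<^esub> Ua (f \<boxtimes>\<^bsub>C\<^esub> g) =
    (Ua f \<boxtimes>\<^bsub>D\<^esub> Ua g) \<cdot>\<^bsub>D\<^esub> inva D (lam S (src C f) (src C g))"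
proof -
  have "inva D (lam S (tgt C f) (tgt C g)) \<cdot>\<^bsub>D\<^esub> Ua (f \<boxtimes>\<^bsub>C\<^esub> g) =
    inva D (lam S (tgt C f) (tgt C g)) \<cdot>\<^bsub>D\<^esub> (Ua (f \<boxtimes>\<^bsub>C\<^esub> g) \<cdot>\<^bsub>D\<^esub> lam S (src C f) (src C g))
      \<cdot>\<^bsub>D\<^esub> inva D (lam S (src C f) (src C g))"
    using assms by simp
  also have "\<dots> = (Ua f \<boxtimes>\<^bsub>D\<^esub> Ua g) \<cdot>\<^bsub>D\<^esub> inva D (lam S (src C f) (src C g))"
    unfolding lam_nat[OF assms, symmetric] using assms by simp
  finally show ?thesis .
qed

lemma operator_dual_2:
  assumes A: "A \<in> obj C" and a: "a \<in> hom D (Uo A \<otimes>\<^bsub>D\<^esub> Uo A) (Uo A \<otimes>\<^bsub>D\<^esub> Uo A)"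
  defines "i \<equiv> ui (duC S) A" and "N \<equiv> bo (ho A) \<otimes>\<^bsub>C\<^esub> bo (ho A)"
  shows "operator_dual S A 2 2 a = ha ((i \<boxtimes>\<^bsub>C\<^esub> i) \<cdot>\<^bsub>C\<^esub> (eps S (A \<otimes>\<^bsub>C\<^esub> A) \<cdot>\<^bsub>C\<^esub>
    Fa (lam S A A \<cdot>\<^bsub>D\<^esub> (a \<cdot>\<^bsub>D\<^esub> ((Ua (inva C i) \<boxtimes>\<^bsub>D\<^esub> Ua (inva C i))
      \<cdot>\<^bsub>D\<^esub> (inva D (lam S (bo (ho A)) (bo (ho A))) \<cdot>\<^bsub>D\<^esub> dd_U N))))))"
proof -
  let ?AA = "A \<otimes>\<^bsub>C\<^esub> A" and ?j = "inva C i"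
  let ?lam = "lam S A A"
  have i [simp]: "iso C i" "i \<in> arr C" "src C i = A" "tgt C i = bo (ho A)"
    using A by (simp_all add: i_def)
  have a' [simp]: "a \<in> arr D" "src D a = Uo A \<otimes>\<^bsub>D\<^esub> Uo A" "tgt D a = Uo A \<otimes>\<^bsub>D\<^esub> Uo A"
    using a by (auto simp: hom_def)
  have N [simp]: "N \<in> obj C" "bo (ho A) \<otimes>\<^bsub>C\<^esub> bo (ho A) = N"
    using A by (simp_all add: N_def)
  define t where "t = eps S ?AA \<cdot>\<^bsub>C\<^esub> Fa (?lam \<cdot>\<^bsub>D\<^esub> a \<cdot>\<^bsub>D\<^esub> inva D ?lam)"
  have t [simp]: "t \<in> arr C" "src C t = Fo (Uo ?AA)" "tgt C t = ?AA"
    using A by (simp_all add: t_def)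
  have pow: "dual_pow C C' (duC S) A 2 = ha (?j \<boxtimes>\<^bsub>C\<^esub> ?j)"
    using A by (simp add: numeral_2_eq_2 dC.bck.ar_idt[simplified] flip: i_def)
  have inva_pow: "inva C' (ha (?j \<boxtimes>\<^bsub>C\<^esub> ?j)) = ha (i \<boxtimes>\<^bsub>C\<^esub> i)"
    using A by (simp add: dC.hat.inva_ar C.inva_tna)
  have transpose: "operator_transpose S A 2 2 a = t"
    using A by (simp add: operator_transpose_def t_def numeral_2_eq_2 D.tna_idt)
  have "operator_dual S A 2 2 a = ar (TT S) (ha (?j \<boxtimes>\<^bsub>C\<^esub> ?j))
      \<cdot>\<^bsub>C'\<^esub> (dFU S (ho ?AA) \<cdot>\<^bsub>C'\<^esub> ha (Fa (Ua (inva C (ui (duC S) ?AA))))) \<cdot>\<^bsub>C'\<^esub> ha t \<cdot>\<^bsub>C'\<^esub> ha (i \<boxtimes>\<^bsub>C\<^esub> i)"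
    using A unfolding operator_dual_def Let_def pow transpose inva_pow
    by (simp add: numeral_2_eq_2 TT_hat dFU_eq)
  also have "\<dots> = ha ((i \<boxtimes>\<^bsub>C\<^esub> i) \<cdot>\<^bsub>C\<^esub> (t \<cdot>\<^bsub>C\<^esub>
      Fa (dd_U ?AA \<cdot>\<^bsub>D\<^esub> (inva D (dd_U ?AA) \<cdot>\<^bsub>D\<^esub> (Ua (?j \<boxtimes>\<^bsub>C\<^esub> ?j) \<cdot>\<^bsub>D\<^esub> dd_U N)))))"
    using A by (simp add: dFU_hat TT_hat flip: dC.hat_cmp adj.F.ar_cmp_arr)
  also have "\<dots> = ha ((i \<boxtimes>\<^bsub>C\<^esub> i) \<cdot>\<^bsub>C\<^esub> (eps S ?AA \<cdot>\<^bsub>C\<^esub>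
      Fa (?lam \<cdot>\<^bsub>D\<^esub> (a \<cdot>\<^bsub>D\<^esub> ((inva D ?lam \<cdot>\<^bsub>D\<^esub> Ua (?j \<boxtimes>\<^bsub>C\<^esub> ?j)) \<cdot>\<^bsub>D\<^esub> dd_U N)))))"
    using A by (simp add: t_def flip: adj.F.ar_cmp_arr)
  also have "inva D ?lam \<cdot>\<^bsub>D\<^esub> Ua (?j \<boxtimes>\<^bsub>C\<^esub> ?j)
      = (Ua ?j \<boxtimes>\<^bsub>D\<^esub> Ua ?j) \<cdot>\<^bsub>D\<^esub> inva D (lam S (bo (ho A)) (bo (ho A)))"
    using A inva_lam_nat[of ?j ?j] by simp
  finally show ?thesis
    using A by simp
qed

lemma transpose_tna_delta:
  assumes obj: "X \<in> obj C" "Y \<in> obj C" "A \<in> obj C" "B \<in> obj C"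
    and u: "u \<in> hom D (Uo X) (Uo A)" and v: "v \<in> hom D (Uo Y) (Uo B)"
  shows "((eps S A \<cdot>\<^bsub>C\<^esub> Fa u) \<boxtimes>\<^bsub>C\<^esub> (eps S B \<cdot>\<^bsub>C\<^esub> Fa v)) \<cdot>\<^bsub>C\<^esub> delta S X Y
    = eps S (A \<otimes>\<^bsub>C\<^esub> B) \<cdot>\<^bsub>C\<^esub> Fa (lam S A B \<cdot>\<^bsub>D\<^esub> ((u \<boxtimes>\<^bsub>D\<^esub> v) \<cdot>\<^bsub>D\<^esub> inva D (lam S X Y)))"
proof -
  define r where "r = eps S A \<cdot>\<^bsub>C\<^esub> Fa u"
  define s where "s = eps S B \<cdot>\<^bsub>C\<^esub> Fa v"
  let ?P = "Fo (Uo X)" and ?Q = "Fo (Uo Y)"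
  let ?e = "(eta S (Uo X) \<boxtimes>\<^bsub>D\<^esub> eta S (Uo Y)) \<cdot>\<^bsub>D\<^esub> inva D (lam S X Y)"
  have u' [simp]: "u \<in> arr D" "src D u = Uo X" "tgt D u = Uo A"
    and v' [simp]: "v \<in> arr D" "src D v = Uo Y" "tgt D v = Uo B"
    using u v by (auto simp: hom_def)
  have [simp]: "r \<in> arr C" "src C r = ?P" "tgt C r = A" "s \<in> arr C" "src C s = ?Q" "tgt C s = B"
    using obj by (simp_all add: r_def s_def)
  have tr: "Ua r \<cdot>\<^bsub>D\<^esub> eta S (Uo X) = u" "Ua s \<cdot>\<^bsub>D\<^esub> eta S (Uo Y) = v"
    using obj transpose_transpose[of A u] transpose_transpose[of B v] by (simp_all add: r_def s_def)
  have "(r \<boxtimes>\<^bsub>C\<^esub> s) \<cdot>\<^bsub>C\<^esub> delta S X Y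
      = ((r \<boxtimes>\<^bsub>C\<^esub> s) \<cdot>\<^bsub>C\<^esub> eps S (?P \<otimes>\<^bsub>C\<^esub> ?Q)) \<cdot>\<^bsub>C\<^esub> Fa (lam S ?P ?Q \<cdot>\<^bsub>D\<^esub> ?e)"
    using obj by (simp add: delta_def adj.F.ar_cmp_arr)
  also have "\<dots> = eps S (A \<otimes>\<^bsub>C\<^esub> B) \<cdot>\<^bsub>C\<^esub> Fa ((Ua (r \<boxtimes>\<^bsub>C\<^esub> s) \<cdot>\<^bsub>D\<^esub> lam S ?P ?Q) \<cdot>\<^bsub>D\<^esub> ?e)"
    using obj eps_nat[of "r \<boxtimes>\<^bsub>C\<^esub> s", symmetric] by (simp add: adj.F.ar_cmp_arr)
  also have "Ua (r \<boxtimes>\<^bsub>C\<^esub> s) \<cdot>\<^bsub>D\<^esub> lam S ?P ?Q = lam S A B \<cdot>\<^bsub>D\<^esub> (Ua r \<boxtimes>\<^bsub>D\<^esub> Ua s)"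
    using lam_nat[of r s] by simp
  also have "(lam S A B \<cdot>\<^bsub>D\<^esub> (Ua r \<boxtimes>\<^bsub>D\<^esub> Ua s)) \<cdot>\<^bsub>D\<^esub> ?e
      = lam S A B \<cdot>\<^bsub>D\<^esub> (((Ua r \<boxtimes>\<^bsub>D\<^esub> Ua s) \<cdot>\<^bsub>D\<^esub> (eta S (Uo X) \<boxtimes>\<^bsub>D\<^esub> eta S (Uo Y)))
          \<cdot>\<^bsub>D\<^esub> inva D (lam S X Y))"
    using obj by simp
  also have "(Ua r \<boxtimes>\<^bsub>D\<^esub> Ua s) \<cdot>\<^bsub>D\<^esub> (eta S (Uo X) \<boxtimes>\<^bsub>D\<^esub> eta S (Uo Y)) = u \<boxtimes>\<^bsub>D\<^esub> v"
    using obj by (simp add: D.tna_cmp_arr tr)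
  finally show ?thesis
    by (simp add: r_def s_def)
qed

lemma delta_arr [simp]:
  assumes "X \<in> obj C" "Y \<in> obj C"
  shows "delta S X Y \<in> arr C" "src C (delta S X Y) = Fo (Uo (X \<otimes>\<^bsub>C\<^esub> Y))"
    "tgt C (delta S X Y) = Fo (Uo X) \<otimes>\<^bsub>C\<^esub> Fo (Uo Y)"
  using assms by (simp_all add: delta_def)

lemma delta_hat_hat:
  assumes A: "A \<in> obj C" and B: "B \<in> obj C"
  defines "i \<equiv> ui (duC S)" and "k \<equiv> ui (duD S)" and "V \<equiv> \<lambda>Z. Uo (bo (ho Z))"
  shows "delta_hat S (ho A) (ho B) =
    ha (((i (Fo (ddD (V A))) \<cdot>\<^bsub>C\<^esub> Fa (k (V A))) \<boxtimes>\<^bsub>C\<^esub> (i (Fo (ddD (V B))) \<cdot>\<^bsub>C\<^esub> Fa (k (V B))))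
      \<cdot>\<^bsub>C\<^esub> (delta S (bo (ho A)) (bo (ho B)) \<cdot>\<^bsub>C\<^esub> Fa (dd_U (bo (ho A) \<otimes>\<^bsub>C\<^esub> bo (ho B)))))"
proof -
  let ?N = "bo (ho A) \<otimes>\<^bsub>C\<^esub> bo (ho B)"
  let ?c = "\<lambda>Z. i (Fo (ddD (V Z))) \<cdot>\<^bsub>C\<^esub> (Fa (k (V Z)) \<cdot>\<^bsub>C\<^esub> inva C (i (Fo (V Z))))"
  have inva_dFU: "ba (inva C' (dFU S (ho Z))) = ?c Z" if "Z \<in> obj C" for Z
    using that by (simp add: dFU_eq dC.hat.inva_ar adj.F.inva_ar dC.bck_hat_ar i_def k_def V_def)
  have "delta_hat S (ho A) (ho B) = (dFU S (ho ?N) \<cdot>\<^bsub>C'\<^esub> ha (Fa (Ua (inva C (i ?N)))))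
      \<cdot>\<^bsub>C'\<^esub> ha (delta S (bo (ho A)) (bo (ho B))) \<cdot>\<^bsub>C'\<^esub> ha (i (Fo (V A)) \<boxtimes>\<^bsub>C\<^esub> i (Fo (V B)))
      \<cdot>\<^bsub>C'\<^esub> ha (?c A \<boxtimes>\<^bsub>C\<^esub> ?c B)"
    using A B by (simp add: delta_hat_def Let_def inva_dFU i_def V_def)
  also have "\<dots> = ha (((?c A \<boxtimes>\<^bsub>C\<^esub> ?c B) \<cdot>\<^bsub>C\<^esub> (i (Fo (V A)) \<boxtimes>\<^bsub>C\<^esub> i (Fo (V B))))
      \<cdot>\<^bsub>C\<^esub> (delta S (bo (ho A)) (bo (ho B)) \<cdot>\<^bsub>C\<^esub> Fa (dd_U ?N)))"
    using A B by (simp add: i_def k_def V_def dFU_hat flip: dC.hat_cmp)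
  also have "(?c A \<boxtimes>\<^bsub>C\<^esub> ?c B) \<cdot>\<^bsub>C\<^esub> (i (Fo (V A)) \<boxtimes>\<^bsub>C\<^esub> i (Fo (V B)))
      = (i (Fo (ddD (V A))) \<cdot>\<^bsub>C\<^esub> Fa (k (V A))) \<boxtimes>\<^bsub>C\<^esub> (i (Fo (ddD (V B))) \<cdot>\<^bsub>C\<^esub> Fa (k (V B)))"
    using A B by (simp add: C.tna_cmp_arr i_def k_def V_def)
  finally show ?thesis .
qed

lemma operator_dual_tensor:
  assumes A: "A \<in> obj C" and h: "h \<in> hom D (Uo A) (Uo A)" and g: "g \<in> hom D (Uo A) (Uo A)"
  shows "delta_hat S (ho A) (ho A) \<cdot>\<^bsub>C'\<^esub> (operator_dual S A 1 1 h \<boxtimes>\<^bsub>CM S\<^esub> operator_dual S A 1 1 g)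
    = operator_dual S A 2 2 (h \<boxtimes>\<^bsub>D\<^esub> g)"
proof -
  define i where "i = ui (duC S) A"
  let ?j = "inva C i" and ?X = "bo (ho A)"
  let ?V = "Uo ?X"
  let ?W = "ddD ?V" and ?k = "ui (duD S) ?V" and ?N = "?X \<otimes>\<^bsub>C\<^esub> ?X"
  let ?b = "ui (duC S) (Fo ?W)"
  let ?r = "\<lambda>a. eps S A \<cdot>\<^bsub>C\<^esub> Fa (a \<cdot>\<^bsub>D\<^esub> dd_U A)"
  let ?t = "\<lambda>a. eps S A \<cdot>\<^bsub>C\<^esub> Fa (a \<cdot>\<^bsub>D\<^esub> Ua ?j)"
  let ?d = "delta S ?X ?X" and ?lam = "lam S ?X ?X"
  have [simp]: "iso C i" "i \<in> arr C" "src C i = A" "tgt C i = ?X"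
    using A by (simp_all add: i_def)
  have [simp]: "h \<in> arr D" "src D h = Uo A" "tgt D h = Uo A"
    "g \<in> arr D" "src D g = Uo A" "tgt D g = Uo A"
    using h g by (auto simp: hom_def)
  have bck: "ba (operator_dual S A 1 1 a) = i \<cdot>\<^bsub>C\<^esub> (?r a \<cdot>\<^bsub>C\<^esub> inva C ?b)"
    if "a \<in> hom D (Uo A) (Uo A)" for a
    using A that unfolding operator_dual_1[OF A that] by (simp add: dC.bck_hat_ar i_def hom_def)
  have factor: "(i \<cdot>\<^bsub>C\<^esub> (?r a \<cdot>\<^bsub>C\<^esub> inva C ?b)) \<cdot>\<^bsub>C\<^esub> (?b \<cdot>\<^bsub>C\<^esub> Fa ?k) = i \<cdot>\<^bsub>C\<^esub> ?t a"
    if "a \<in> hom D (Uo A) (Uo A)" for a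
    using A that by (simp add: hom_def dd_U_def i_def flip: adj.F.ar_cmp_arr)
  have "delta_hat S (ho A) (ho A) \<cdot>\<^bsub>C'\<^esub> (operator_dual S A 1 1 h \<boxtimes>\<^bsub>CM S\<^esub> operator_dual S A 1 1 g)
      = ha (((?b \<cdot>\<^bsub>C\<^esub> Fa ?k) \<boxtimes>\<^bsub>C\<^esub> (?b \<cdot>\<^bsub>C\<^esub> Fa ?k)) \<cdot>\<^bsub>C\<^esub> (?d \<cdot>\<^bsub>C\<^esub> Fa (dd_U ?N)))
        \<cdot>\<^bsub>C'\<^esub> ha ((i \<cdot>\<^bsub>C\<^esub> (?r h \<cdot>\<^bsub>C\<^esub> inva C ?b)) \<boxtimes>\<^bsub>C\<^esub> (i \<cdot>\<^bsub>C\<^esub> (?r g \<cdot>\<^bsub>C\<^esub> inva C ?b)))"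
    using A by (simp only: CM_simps bck[OF h] bck[OF g] delta_hat_hat)
  also have "\<dots> = ha ((((i \<cdot>\<^bsub>C\<^esub> (?r h \<cdot>\<^bsub>C\<^esub> inva C ?b)) \<boxtimes>\<^bsub>C\<^esub> (i \<cdot>\<^bsub>C\<^esub> (?r g \<cdot>\<^bsub>C\<^esub> inva C ?b)))
        \<cdot>\<^bsub>C\<^esub> ((?b \<cdot>\<^bsub>C\<^esub> Fa ?k) \<boxtimes>\<^bsub>C\<^esub> (?b \<cdot>\<^bsub>C\<^esub> Fa ?k))) \<cdot>\<^bsub>C\<^esub> (?d \<cdot>\<^bsub>C\<^esub> Fa (dd_U ?N)))"
    using A by (simp flip: dC.hat_cmp)
  also have "((i \<cdot>\<^bsub>C\<^esub> (?r h \<cdot>\<^bsub>C\<^esub> inva C ?b)) \<boxtimes>\<^bsub>C\<^esub> (i \<cdot>\<^bsub>C\<^esub> (?r g \<cdot>\<^bsub>C\<^esub> inva C ?b)))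
      \<cdot>\<^bsub>C\<^esub> ((?b \<cdot>\<^bsub>C\<^esub> Fa ?k) \<boxtimes>\<^bsub>C\<^esub> (?b \<cdot>\<^bsub>C\<^esub> Fa ?k)) = (i \<cdot>\<^bsub>C\<^esub> ?t h) \<boxtimes>\<^bsub>C\<^esub> (i \<cdot>\<^bsub>C\<^esub> ?t g)"
    unfolding factor[OF h, symmetric] factor[OF g, symmetric] using A by (subst C.tna_cmp_arr) simp_all
  also have "\<dots> = (i \<boxtimes>\<^bsub>C\<^esub> i) \<cdot>\<^bsub>C\<^esub> (?t h \<boxtimes>\<^bsub>C\<^esub> ?t g)"
    using A by (simp add: C.tna_cmp_arr)
  also have "((i \<boxtimes>\<^bsub>C\<^esub> i) \<cdot>\<^bsub>C\<^esub> (?t h \<boxtimes>\<^bsub>C\<^esub> ?t g)) \<cdot>\<^bsub>C\<^esub> (?d \<cdot>\<^bsub>C\<^esub> Fa (dd_U ?N))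
      = (i \<boxtimes>\<^bsub>C\<^esub> i) \<cdot>\<^bsub>C\<^esub> (((?t h \<boxtimes>\<^bsub>C\<^esub> ?t g) \<cdot>\<^bsub>C\<^esub> ?d) \<cdot>\<^bsub>C\<^esub> Fa (dd_U ?N))"
    using A by simp
  also have "(?t h \<boxtimes>\<^bsub>C\<^esub> ?t g) \<cdot>\<^bsub>C\<^esub> ?d = eps S (A \<otimes>\<^bsub>C\<^esub> A) \<cdot>\<^bsub>C\<^esub>
      Fa (lam S A A \<cdot>\<^bsub>D\<^esub> (((h \<cdot>\<^bsub>D\<^esub> Ua ?j) \<boxtimes>\<^bsub>D\<^esub> (g \<cdot>\<^bsub>D\<^esub> Ua ?j)) \<cdot>\<^bsub>D\<^esub> inva D ?lam))"
    using A by (intro transpose_tna_delta) (simp_all add: hom_def)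
  also have "(h \<cdot>\<^bsub>D\<^esub> Ua ?j) \<boxtimes>\<^bsub>D\<^esub> (g \<cdot>\<^bsub>D\<^esub> Ua ?j) = (h \<boxtimes>\<^bsub>D\<^esub> g) \<cdot>\<^bsub>D\<^esub> (Ua ?j \<boxtimes>\<^bsub>D\<^esub> Ua ?j)"
    by (simp add: D.tna_cmp_arr)
  also have "ha ((i \<boxtimes>\<^bsub>C\<^esub> i) \<cdot>\<^bsub>C\<^esub> ((eps S (A \<otimes>\<^bsub>C\<^esub> A) \<cdot>\<^bsub>C\<^esub>
      Fa (lam S A A \<cdot>\<^bsub>D\<^esub> (((h \<boxtimes>\<^bsub>D\<^esub> g) \<cdot>\<^bsub>D\<^esub> (Ua ?j \<boxtimes>\<^bsub>D\<^esub> Ua ?j)) \<cdot>\<^bsub>D\<^esub> inva D ?lam)))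
      \<cdot>\<^bsub>C\<^esub> Fa (dd_U ?N))) = operator_dual S A 2 2 (h \<boxtimes>\<^bsub>D\<^esub> g)"
    using A by (simp add: operator_dual_2 hom_def adj.F.ar_cmp_arr flip: i_def)
  finally show ?thesis .
qed

end

theorem proposition3p12:
  fixes S :: "('c, 'ca, 'd, 'da, 'x, 'xa, 'y, 'ya) setting"
    and A :: 'c and h g :: 'da and \<rho> \<sigma> :: 'xa
  assumes "monoidal_adjunction_duality S"
    and "A \<in> obj (CC S)"
    and "is_dual_operator S A 1 1 h \<rho>"
    and "is_dual_operator S A 1 1 g \<sigma>"
  shows "is_dual_operator S A 2 2 (h \<boxtimes>\<^bsub>DD S\<^esub> g)
           (delta_hat S (ob (hat (duC S)) A) (ob (hat (duC S)) A) \<cdot>\<^bsub>CH S\<^esub> (\<rho> \<boxtimes>\<^bsub>CM S\<^esub> \<sigma>))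
       \<and> is_dual_operator S A 1 1 (g \<cdot>\<^bsub>DD S\<^esub> h)
           (T_mult S (ob (hat (duC S)) A) \<cdot>\<^bsub>CH S\<^esub> ar (TT S) \<rho> \<cdot>\<^bsub>CH S\<^esub> \<sigma>)
       \<and> is_dual_operator S A 1 1 (idt (DD S) (ob (UU S) A)) (T_unit S (ob (hat (duC S)) A))"
proof -
  interpret monoidal_adjunction_duality S by fact
  note A = assms(2)
  have op1: "U_operator S A 1 1 a \<longleftrightarrow> a \<in> hom D (Uo A) (Uo A)"
    and op2: "U_operator S A 2 2 a \<longleftrightarrow> a \<in> hom D (Uo A \<otimes>\<^bsub>D\<^esub> Uo A) (Uo A \<otimes>\<^bsub>D\<^esub> Uo A)" for a
    using A by (simp_all add: U_operator_def numeral_2_eq_2)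
  have dual1: "is_dual_operator S A 1 1 a (operator_dual S A 1 1 a)"
    if "a \<in> hom D (Uo A) (Uo A)" for a
    using A that unfolding is_dual_operator_def op1 operator_dual_1[OF A that]
    by (simp add: hom_def)
  have dual2: "is_dual_operator S A 2 2 a (operator_dual S A 2 2 a)"
    if "a \<in> hom D (Uo A \<otimes>\<^bsub>D\<^esub> Uo A) (Uo A \<otimes>\<^bsub>D\<^esub> Uo A)" for a
    using A that unfolding is_dual_operator_def op2 operator_dual_2[OF A that]
    by (simp add: hom_def numeral_2_eq_2)
  have h: "h \<in> hom D (Uo A) (Uo A)" "\<rho> = operator_dual S A 1 1 h"
    and g: "g \<in> hom D (Uo A) (Uo A)" "\<sigma> = operator_dual S A 1 1 g"
    using assms(3,4) unfolding is_dual_operator_def op1 by blast+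
  show ?thesis
    unfolding h(2) g(2) operator_dual_tensor[OF A h(1) g(1)] operator_dual_cmp[OF A h(1) g(1)] operator_dual_idt[OF A]
    by (intro conjI dual1 dual2 D.tna_hom D.cmp_hom[OF h(1) g(1)] D.idt_hom adj.U.ob_obj A h(1) g(1))
qed

end
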